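(* Let $\mathbf{V}$ be a nontrivial variety of lattices, $\mathcal{L} = (L_i \mid i\in I)$ a family of lattices in $\mathbf{V}$, and $(\varphi_i\colon L_i\to M\mid i\in I)$ a family of isotone maps from the $L_i$ to a lattice $M$ not necessarily in $\mathbf{V}$. Then there exists an isotone map $\varphi\colon \mathrm{Free}_{\mathbf{V}}\mathcal{L}\to M$ whose restriction to each $L_i\subseteq \mathrm{Free}_{\mathbf{V}}\mathcal{L}$ is $\varphi_i$.
   Context: Lattices are nonempty. An isotone map is an order-preserving map (not assumed to be a lattice homomorphism). A variety of lattices (equational class) is nontrivial if it has a member with more than one element. $\mathrm{Free}_{\mathbf{V}}\mathcal{L}$ denotes the free product of the $L_i$ in $\mathbf{V}$: a lattice in $\mathbf{V}$ with lattice homomorphisms $L_i\to \mathrm{Free}_{\mathbf{V}}\mathcal{L}$ ($i\in I$) such that every family of lattice homomorphisms from the $L_i$ to a common lattice in $\mathbf{V}$ factors uniquely through a lattice homomorphism on $\mathrm{Free}_{\mathbf{V}}\mathcal{L}$ (the coproduct in $\mathbf{V}$). The canonical homomorphisms $L_i\to \mathrm{Free}_{\mathbf{V}}\mathcal{L}$ are embeddings and each $L_i$ is identified with its image; the restriction of a map to $L_i$ means its composite with the canonical embedding. *)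

theory Defs
  imports "HOL-Algebra.Lattice"
begin

section \<open>Varieties of lattices\<close>

datatype 'v lterm =
    LVar 'v
  | LMeet "'v lterm" "'v lterm"
  | LJoin "'v lterm" "'v lterm"

primrec eval_lterm :: "('a, 'm) gorder_scheme \<Rightarrow> ('v \<Rightarrow> 'a) \<Rightarrow> 'v lterm \<Rightarrow> 'a" where
  "eval_lterm L a (LVar v) = a v"
| "eval_lterm L a (LMeet s t) = eval_lterm L a s \<sqinter>\<^bsub>L\<^esub> eval_lterm L a t"
| "eval_lterm L a (LJoin s t) = eval_lterm L a s \<squnion>\<^bsub>L\<^esub> eval_lterm L a t"

text \<open>
  A variety is an equational class, so it is given by a set \<open>V\<close> of lattice identities in
  countably many variables; its members, of any type, are the nonempty lattices satisfying
  all of them.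
\<close>

definition in_variety :: "(nat lterm \<times> nat lterm) set \<Rightarrow> 'a gorder \<Rightarrow> bool" where
  "in_variety V L \<longleftrightarrow>
     Lattice.lattice L \<and> carrier L \<noteq> {} \<and>
     (\<forall>(s, t) \<in> V. \<forall>a. (\<forall>n. a n \<in> carrier L) \<longrightarrow> eval_lterm L a s = eval_lterm L a t)"

text \<open>
  HOL cannot quantify over types inside a formula. Here the type argument says where the
  witness lives; a theorem assuming \<open>nontrivial_variety TYPE('w) V\<close> for a type variable
  \<open>'w\<close> applies to a witness of any type.
\<close>

definition nontrivial_variety :: "'w itself \<Rightarrow> (nat lterm \<times> nat lterm) set \<Rightarrow> bool" where
  "nontrivial_variety _ V \<longleftrightarrow>
     (\<exists>W :: 'w gorder. in_variety V W \<and> (\<exists>x\<in>carrier W. \<exists>y\<in>carrier W. x \<noteq> y))"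

definition lattice_hom :: "'a gorder \<Rightarrow> 'b gorder \<Rightarrow> ('a \<Rightarrow> 'b) \<Rightarrow> bool" where
  "lattice_hom A B f \<longleftrightarrow>
     f \<in> carrier A \<rightarrow> carrier B \<and> join_pres A B f \<and> meet_pres A B f"

section \<open>Free products\<close>

text \<open>
  The coproduct property of the maps \<open>j i\<close> from \<open>L i\<close> to \<open>F\<close>, tested against
  the members of \<open>V\<close> carried by subsets of the type \<open>'t\<close>.
\<close>

definition universal_for ::
  "'t itself \<Rightarrow> (nat lterm \<times> nat lterm) set \<Rightarrow> 'i set \<Rightarrow> ('i \<Rightarrow> 'a gorder) \<Rightarrow>
     'f gorder \<Rightarrow> ('i \<Rightarrow> 'a \<Rightarrow> 'f) \<Rightarrow> bool" where
  "universal_for _ V I L F j \<longleftrightarrow>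
     (\<forall>(N :: 't gorder) g.
        in_variety V N \<longrightarrow> (\<forall>i\<in>I. lattice_hom (L i) N (g i)) \<longrightarrow>
        (\<exists>h. lattice_hom F N h \<and> (\<forall>i\<in>I. \<forall>x\<in>carrier (L i). h (j i x) = g i x) \<and>
             (\<forall>h'. lattice_hom F N h' \<and> (\<forall>i\<in>I. \<forall>x\<in>carrier (L i). h' (j i x) = g i x)
                   \<longrightarrow> (\<forall>z\<in>carrier F. h' z = h z))))"

text \<open>
  The universal property must hold against members of \<open>V\<close> of every type, which cannot be
  written as one formula. Two test types suffice: the type of \<open>F\<close> itself and a type large
  enough to carry a coproduct built from terms. For \<open>I \<noteq> {}\<close>,
  \<open>free_product_universal\<close> below shows that these two imply the property for every type,
  and \<open>free_product_exists\<close> that free products exist. (Lattices being nonempty, the empty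
  family has no free product in a nontrivial variety.)
\<close>

definition free_product ::
  "(nat lterm \<times> nat lterm) set \<Rightarrow> 'i set \<Rightarrow> ('i \<Rightarrow> 'a gorder) \<Rightarrow>
     'f gorder \<Rightarrow> ('i \<Rightarrow> 'a \<Rightarrow> 'f) \<Rightarrow> bool" where
  "free_product V I L F j \<longleftrightarrow>
     in_variety V F \<and> (\<forall>i\<in>I. lattice_hom (L i) F (j i)) \<and>
     universal_for TYPE('f) V I L F j \<and>
     universal_for TYPE(('i \<times> 'a) lterm set) V I L F j"

section \<open>Existence and full universality of free products\<close>

lemma join_eqI:
  assumes "Lattice.lattice L" "x \<in> carrier L" "y \<in> carrier L" "z \<in> carrier L"
    "x \<sqsubseteq>\<^bsub>L\<^esub> z" "y \<sqsubseteq>\<^bsub>L\<^esub> z"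
    "\<And>w. w \<in> carrier L \<Longrightarrow> x \<sqsubseteq>\<^bsub>L\<^esub> w \<Longrightarrow> y \<sqsubseteq>\<^bsub>L\<^esub> w \<Longrightarrow> z \<sqsubseteq>\<^bsub>L\<^esub> w"
  shows "x \<squnion>\<^bsub>L\<^esub> y = z"
proof -
  interpret Lattice.lattice L by fact
  show ?thesis
    using assms by (intro le_antisym join_le assms(7)) (simp_all add: join_left join_right)
qed

lemma meet_eqI:
  assumes "Lattice.lattice L" "x \<in> carrier L" "y \<in> carrier L" "z \<in> carrier L"
    "z \<sqsubseteq>\<^bsub>L\<^esub> x" "z \<sqsubseteq>\<^bsub>L\<^esub> y"
    "\<And>w. w \<in> carrier L \<Longrightarrow> w \<sqsubseteq>\<^bsub>L\<^esub> x \<Longrightarrow> w \<sqsubseteq>\<^bsub>L\<^esub> y \<Longrightarrow> w \<sqsubseteq>\<^bsub>L\<^esub> z"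
  shows "x \<sqinter>\<^bsub>L\<^esub> y = z"
proof -
  interpret Lattice.lattice L by fact
  show ?thesis
    using assms by (intro le_antisym meet_le assms(7)) (simp_all add: meet_left meet_right)
qed

lemma eval_closed:
  assumes "Lattice.lattice L" "\<And>v. v \<in> set_lterm t \<Longrightarrow> a v \<in> carrier L"
  shows "eval_lterm L a t \<in> carrier L"
proof -
  interpret Lattice.lattice L by fact
  show ?thesis using assms(2) by (induction t) auto
qed

lemma universal_forE:
  fixes N :: "'t gorder"
  assumes "universal_for TYPE('t) V I L F j" "in_variety V N"
    "\<forall>i\<in>I. lattice_hom (L i) N (g i)"
  obtains h where "lattice_hom F N h" "\<forall>i\<in>I. \<forall>x\<in>carrier (L i). h (j i x) = g i x"
    "\<forall>h'. lattice_hom F N h' \<and> (\<forall>i\<in>I. \<forall>x\<in>carrier (L i). h' (j i x) = g i x) \<longrightarrow>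
       (\<forall>z\<in>carrier F. h' z = h z)"
proof -
  from assms(1)[unfolded universal_for_def, THEN spec, THEN spec, THEN mp, OF assms(2),
      THEN mp, OF assms(3)]
  show thesis by (elim exE conjE) (rule that)
qed

primrec subst_lterm :: "('v \<Rightarrow> 'w lterm) \<Rightarrow> 'v lterm \<Rightarrow> 'w lterm" where
  "subst_lterm \<sigma> (LVar v) = \<sigma> v"
| "subst_lterm \<sigma> (LMeet s t) = LMeet (subst_lterm \<sigma> s) (subst_lterm \<sigma> t)"
| "subst_lterm \<sigma> (LJoin s t) = LJoin (subst_lterm \<sigma> s) (subst_lterm \<sigma> t)"

lemma eval_subst: "eval_lterm L a (subst_lterm \<sigma> t) = eval_lterm L (\<lambda>v. eval_lterm L a (\<sigma> v)) t"
  by (induction t) auto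

lemma hom_comp:
  assumes "lattice_hom A B f" "lattice_hom B C g"
  shows "lattice_hom A C (g \<circ> f)"
  using assms unfolding lattice_hom_def join_pres_def meet_pres_def
  by (simp add: Pi_iff)

lemma hom_id: "Lattice.lattice A \<Longrightarrow> lattice_hom A A id"
  unfolding lattice_hom_def join_pres_def meet_pres_def by auto

context
  fixes V :: "(nat lterm \<times> nat lterm) set" and I :: "'i set" and L :: "'i \<Rightarrow> 'a gorder"
begin

inductive fple :: "('i \<times> 'a) lterm \<Rightarrow> ('i \<times> 'a) lterm \<Rightarrow> bool" where
  refl: "fple t t"
| trans: "fple s t \<Longrightarrow> fple t u \<Longrightarrow> fple s u"
| meet1: "fple (LMeet s t) s"
| meet2: "fple (LMeet s t) t"
| meet_greatest: "fple u s \<Longrightarrow> fple u t \<Longrightarrow> fple u (LMeet s t)"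
| join1: "fple s (LJoin s t)"
| join2: "fple t (LJoin s t)"
| join_least: "fple s u \<Longrightarrow> fple t u \<Longrightarrow> fple (LJoin s t) u"
| law1: "(s, t) \<in> V \<Longrightarrow> fple (subst_lterm \<sigma> s) (subst_lterm \<sigma> t)"
| law2: "(s, t) \<in> V \<Longrightarrow> fple (subst_lterm \<sigma> t) (subst_lterm \<sigma> s)"
| gen_meet: "i \<in> I \<Longrightarrow> x \<in> carrier (L i) \<Longrightarrow> y \<in> carrier (L i) \<Longrightarrow>
    fple (LMeet (LVar (i, x)) (LVar (i, y))) (LVar (i, x \<sqinter>\<^bsub>L i\<^esub> y))"
| gen_meet': "i \<in> I \<Longrightarrow> x \<in> carrier (L i) \<Longrightarrow> y \<in> carrier (L i) \<Longrightarrow>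
    fple (LVar (i, x \<sqinter>\<^bsub>L i\<^esub> y)) (LMeet (LVar (i, x)) (LVar (i, y)))"
| gen_join: "i \<in> I \<Longrightarrow> x \<in> carrier (L i) \<Longrightarrow> y \<in> carrier (L i) \<Longrightarrow>
    fple (LJoin (LVar (i, x)) (LVar (i, y))) (LVar (i, x \<squnion>\<^bsub>L i\<^esub> y))"
| gen_join': "i \<in> I \<Longrightarrow> x \<in> carrier (L i) \<Longrightarrow> y \<in> carrier (L i) \<Longrightarrow>
    fple (LVar (i, x \<squnion>\<^bsub>L i\<^esub> y)) (LJoin (LVar (i, x)) (LVar (i, y)))"

lemma fple_sound:
  fixes N :: "'t gorder"
  assumes "in_variety V N"
    and hom: "\<And>i. i \<in> I \<Longrightarrow> lattice_hom (L i) N (\<lambda>x. a (i, x))"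
    and a: "\<And>v. a v \<in> carrier N"
    and "fple s t"
  shows "eval_lterm N a s \<sqsubseteq>\<^bsub>N\<^esub> eval_lterm N a t"
proof -
  interpret N: Lattice.lattice N using assms(1) by (simp add: in_variety_def)
  have c: "eval_lterm N a t \<in> carrier N" for t
    by (rule eval_closed) (use a N.lattice_axioms in auto)
  have law: "eval_lterm N a (subst_lterm \<sigma> s) = eval_lterm N a (subst_lterm \<sigma> t)"
    if "(s, t) \<in> V" for s t \<sigma>
    using assms(1) that c unfolding in_variety_def eval_subst by auto
  have pm: "a (i, x \<sqinter>\<^bsub>L i\<^esub> y) = a (i, x) \<sqinter>\<^bsub>N\<^esub> a (i, y)"
    and pj: "a (i, x \<squnion>\<^bsub>L i\<^esub> y) = a (i, x) \<squnion>\<^bsub>N\<^esub> a (i, y)"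
    if "i \<in> I" "x \<in> carrier (L i)" "y \<in> carrier (L i)" for i x y
    using hom[OF that(1)] that unfolding lattice_hom_def meet_pres_def join_pres_def by auto
  from \<open>fple s t\<close> show ?thesis
  proof induction
    case (trans s t u)
    show ?case by (rule N.le_trans[OF trans.IH c c c])
  qed (auto simp: c a law pm pj N.meet_left N.meet_right N.join_left N.join_right
        N.meet_le N.join_le)
qed

definition fpcls :: "('i \<times> 'a) lterm \<Rightarrow> ('i \<times> 'a) lterm set" where
  "fpcls t = {s. fple s t \<and> fple t s}"

definition fpterms :: "('i \<times> 'a) lterm set" where
  "fpterms = {t. set_lterm t \<subseteq> {(i, x). i \<in> I \<and> x \<in> carrier (L i)}}"

definition term_product :: "('i \<times> 'a) lterm set gorder" where
  "term_product =
     \<lparr> carrier = fpcls ` fpterms, eq = (=), le = (\<lambda>A B. \<exists>s\<in>A. \<exists>t\<in>B. fple s t) \<rparr>"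

definition term_inj :: "'i \<Rightarrow> 'a \<Rightarrow> ('i \<times> 'a) lterm set" where
  "term_inj i x = fpcls (LVar (i, x))"

lemma fpcls_self: "t \<in> fpcls t"
  by (simp add: fpcls_def fple.refl)

lemma fpcls_eq_iff: "fpcls s = fpcls t \<longleftrightarrow> fple s t \<and> fple t s"
  unfolding fpcls_def by (blast intro: fple.refl fple.trans)

lemma le_term_product: "fpcls s \<sqsubseteq>\<^bsub>term_product\<^esub> fpcls t \<longleftrightarrow> fple s t"
  unfolding term_product_def fpcls_def by (auto intro: fple.refl fple.trans)

lemma carrier_term_product: "carrier term_product = fpcls ` fpterms"
  by (simp add: term_product_def)

lemma fpterms_simps [simp]:
  "LMeet s t \<in> fpterms \<longleftrightarrow> s \<in> fpterms \<and> t \<in> fpterms"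
  "LJoin s t \<in> fpterms \<longleftrightarrow> s \<in> fpterms \<and> t \<in> fpterms"
  "LVar (i, x) \<in> fpterms \<longleftrightarrow> i \<in> I \<and> x \<in> carrier (L i)"
  by (auto simp: fpterms_def)

lemma lattice_term_product: "Lattice.lattice term_product"
proof -
  have eq: "(.=\<^bsub>term_product\<^esub>) = (=)" by (simp add: term_product_def)
  have po: "partial_order term_product"
  proof unfold_locales
    fix x y
    assume "x \<sqsubseteq>\<^bsub>term_product\<^esub> y" "y \<sqsubseteq>\<^bsub>term_product\<^esub> x"
      and "x \<in> carrier term_product" "y \<in> carrier term_product"
    moreover from this(3,4) obtain s t where "x = fpcls s" "y = fpcls t"
      by (auto simp: carrier_term_product)
    ultimately have "fpcls s = fpcls t"
      by (simp add: le_term_product fpcls_eq_iff)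
    with \<open>x = fpcls s\<close> \<open>y = fpcls t\<close> show "x .=\<^bsub>term_product\<^esub> y"
      by (simp add: eq)
  next
    fix x y z
    assume "x \<sqsubseteq>\<^bsub>term_product\<^esub> y" "y \<sqsubseteq>\<^bsub>term_product\<^esub> z"
      and "x \<in> carrier term_product" "y \<in> carrier term_product" "z \<in> carrier term_product"
    moreover from this(3-5) obtain s t u where "x = fpcls s" "y = fpcls t" "z = fpcls u"
      by (auto simp: carrier_term_product)
    ultimately show "x \<sqsubseteq>\<^bsub>term_product\<^esub> z"
      by (auto simp: le_term_product intro: fple.trans)
  qed (auto simp: eq carrier_term_product le_term_product fple.refl)
  interpret partial_order term_product by (fact po)
  show ?thesis
  proof unfold_locales
    fix x y assume "x \<in> carrier term_product" "y \<in> carrier term_product"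
    then obtain s t where st: "s \<in> fpterms" "t \<in> fpterms" "x = fpcls s" "y = fpcls t"
      by (auto simp: carrier_term_product)
    have "least term_product (fpcls (LJoin s t)) (Upper term_product {x, y})"
      by (rule least_UpperI)
        (use st in \<open>auto simp: carrier_term_product le_term_product Upper_def
           fple.join1 fple.join2 fple.join_least\<close>)
    then show "\<exists>s. least term_product s (Upper term_product {x, y})" by blast
    have "greatest term_product (fpcls (LMeet s t)) (Lower term_product {x, y})"
      by (rule greatest_LowerI)
        (use st in \<open>auto simp: carrier_term_product le_term_product Lower_def
           fple.meet1 fple.meet2 fple.meet_greatest\<close>)
    then show "\<exists>s. greatest term_product s (Lower term_product {x, y})" by blast
  qed
qed

lemma join_term_product:
  "s \<in> fpterms \<Longrightarrow> t \<in> fpterms \<Longrightarrow> fpcls s \<squnion>\<^bsub>term_product\<^esub> fpcls t = fpcls (LJoin s t)"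
  by (rule join_eqI[OF lattice_term_product])
    (auto simp: carrier_term_product le_term_product
      fple.join1 fple.join2 fple.join_least)

lemma meet_term_product:
  "s \<in> fpterms \<Longrightarrow> t \<in> fpterms \<Longrightarrow> fpcls s \<sqinter>\<^bsub>term_product\<^esub> fpcls t = fpcls (LMeet s t)"
  by (rule meet_eqI[OF lattice_term_product])
    (auto simp: carrier_term_product le_term_product
      fple.meet1 fple.meet2 fple.meet_greatest)

lemma eval_term_product:
  assumes "\<And>v. \<sigma> v \<in> fpterms"
  shows "subst_lterm \<sigma> t \<in> fpterms \<and>
    eval_lterm term_product (\<lambda>v. fpcls (\<sigma> v)) t = fpcls (subst_lterm \<sigma> t)"
  by (induction t) (auto simp: assms join_term_product meet_term_product)

lemma term_product_in_variety:
  assumes "I \<noteq> {}" "\<And>i. i \<in> I \<Longrightarrow> in_variety V (L i)"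
  shows "in_variety V term_product"
proof -
  obtain i x where "i \<in> I" "x \<in> carrier (L i)"
    using assms unfolding in_variety_def by blast
  then have "fpcls (LVar (i, x)) \<in> carrier term_product"
    by (simp add: carrier_term_product)
  moreover have "eval_lterm term_product a s = eval_lterm term_product a t"
    if "(s, t) \<in> V" and a: "\<And>n. a n \<in> carrier term_product" for s t a
  proof -
    have "\<forall>n. \<exists>u. u \<in> fpterms \<and> a n = fpcls u"
      using a by (auto simp: carrier_term_product)
    then obtain \<sigma> where \<sigma>: "\<And>n. \<sigma> n \<in> fpterms" "\<And>n. a n = fpcls (\<sigma> n)" by metis
    then have "a = (\<lambda>n. fpcls (\<sigma> n))" by auto
    then show ?thesis
      using eval_term_product[of \<sigma>] \<sigma> that(1)
      by (simp add: fpcls_eq_iff fple.law1 fple.law2)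
  qed
  ultimately show ?thesis
    using lattice_term_product unfolding in_variety_def by blast
qed

lemma term_inj_hom:
  assumes "\<And>i. i \<in> I \<Longrightarrow> in_variety V (L i)" "i \<in> I"
  shows "lattice_hom (L i) term_product (term_inj i)"
proof -
  interpret Li: Lattice.lattice "L i" using assms by (simp add: in_variety_def)
  have "term_inj i (x \<squnion>\<^bsub>L i\<^esub> y) = term_inj i x \<squnion>\<^bsub>term_product\<^esub> term_inj i y"
    and "term_inj i (x \<sqinter>\<^bsub>L i\<^esub> y) = term_inj i x \<sqinter>\<^bsub>term_product\<^esub> term_inj i y"
    if "x \<in> carrier (L i)" "y \<in> carrier (L i)" for x y
    using assms(2) that
    by (simp_all add: term_inj_def join_term_product meet_term_product fpcls_eq_iff
        fple.gen_meet fple.gen_meet' fple.gen_join fple.gen_join')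
  moreover have "term_inj i \<in> carrier (L i) \<rightarrow> carrier term_product"
    using assms(2) by (simp add: term_inj_def carrier_term_product)
  ultimately show ?thesis
    using lattice_term_product Li.lattice_axioms
    by (simp add: lattice_hom_def join_pres_def meet_pres_def)
qed

lemma term_product_universal: "universal_for TYPE('t) V I L term_product term_inj"
  unfolding universal_for_def
proof (intro allI impI)
  fix N :: "'t gorder" and g
  assume N: "in_variety V N" and g: "\<forall>i\<in>I. lattice_hom (L i) N (g i)"
  then obtain c where c: "c \<in> carrier N" and lat: "Lattice.lattice N"
    by (auto simp: in_variety_def)
  define a where "a = (\<lambda>(i, x). if i \<in> I \<and> x \<in> carrier (L i) then g i x else c)"
  have a: "a v \<in> carrier N" for v
    using g c by (auto simp: a_def lattice_hom_def split: prod.split)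
  have hom: "lattice_hom (L i) N (\<lambda>x. a (i, x))" if "i \<in> I" for i
  proof -
    have h: "lattice_hom (L i) N (g i)" using g that by blast
    then interpret Li: Lattice.lattice "L i" by (simp add: lattice_hom_def join_pres_def)
    show ?thesis using h that by (auto simp: a_def lattice_hom_def join_pres_def meet_pres_def)
  qed
  have ec: "eval_lterm N a t \<in> carrier N" for t
    by (rule eval_closed) (use a lat in auto)
  have ev: "eval_lterm N a s = eval_lterm N a t" if "s \<in> fpcls t" for s t
  proof -
    interpret N: Lattice.lattice N by (fact lat)
    show ?thesis
      using that fple_sound[OF N, of a] hom a ec unfolding fpcls_def
      by (intro N.le_antisym) auto
  qed
  define h where "h = (\<lambda>A. eval_lterm N a (SOME t. t \<in> A))"
  have h: "h (fpcls t) = eval_lterm N a t" for t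
    unfolding h_def by (rule ev, rule someI, rule fpcls_self)
  show "\<exists>h. lattice_hom term_product N h \<and>
          (\<forall>i\<in>I. \<forall>x\<in>carrier (L i). h (term_inj i x) = g i x) \<and>
          (\<forall>h'. lattice_hom term_product N h' \<and>
                (\<forall>i\<in>I. \<forall>x\<in>carrier (L i). h' (term_inj i x) = g i x) \<longrightarrow>
                (\<forall>z\<in>carrier term_product. h' z = h z))"
  proof (intro exI[of _ h] conjI allI impI ballI)
    show "lattice_hom term_product N h"
      unfolding lattice_hom_def join_pres_def meet_pres_def
      using lattice_term_product lat
      by (auto simp: carrier_term_product join_term_product meet_term_product h ec)
    show "h (term_inj i x) = g i x" if "i \<in> I" "x \<in> carrier (L i)" for i x
      using that by (simp add: term_inj_def h a_def)
    fix h' z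
    assume h': "lattice_hom term_product N h' \<and>
                (\<forall>i\<in>I. \<forall>x\<in>carrier (L i). h' (term_inj i x) = g i x)"
      and "z \<in> carrier term_product"
    then obtain t where t: "t \<in> fpterms" "z = fpcls t" by (auto simp: carrier_term_product)
    have "h' (fpcls t) = eval_lterm N a t" using t(1)
    proof (induction t)
      case (LVar v)
      then show ?case using h' by (cases v) (auto simp: term_inj_def a_def)
    next
      case (LMeet s t)
      then have "h' (fpcls s \<sqinter>\<^bsub>term_product\<^esub> fpcls t) = h' (fpcls s) \<sqinter>\<^bsub>N\<^esub> h' (fpcls t)"
        using h' by (simp add: lattice_hom_def meet_pres_def carrier_term_product)
      with LMeet show ?case by (simp add: meet_term_product)
    next
      case (LJoin s t)
      then have "h' (fpcls s \<squnion>\<^bsub>term_product\<^esub> fpcls t) = h' (fpcls s) \<squnion>\<^bsub>N\<^esub> h' (fpcls t)"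
        using h' by (simp add: lattice_hom_def join_pres_def carrier_term_product)
      with LJoin show ?case by (simp add: join_term_product)
    qed
    then show "h' z = h z" by (simp add: t h)
  qed
qed

end

theorem free_product_exists:
  fixes L :: "'i \<Rightarrow> 'a gorder"
  assumes "I \<noteq> {}" "\<And>i. i \<in> I \<Longrightarrow> in_variety V (L i)"
  shows "\<exists>(F :: ('i \<times> 'a) lterm set gorder) j. free_product V I L F j"
proof (intro exI)
  show "free_product V I L (term_product V I L) (term_inj V I L)"
    unfolding free_product_def
    using term_product_in_variety[of I V L] term_inj_hom[of I V L] assms
    by (simp add: term_product_universal)
qed

theorem free_product_universal:
  fixes L :: "'i \<Rightarrow> 'a gorder" and F :: "'f gorder"
  assumes "I \<noteq> {}" "\<And>i. i \<in> I \<Longrightarrow> in_variety V (L i)" "free_product V I L F j"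
  shows "universal_for TYPE('t) V I L F j"
proof -
  let ?T = "term_product V I L" and ?k = "term_inj V I L"
  have F: "in_variety V F" and j: "\<forall>i\<in>I. lattice_hom (L i) F (j i)"
    and uF: "universal_for TYPE('f) V I L F j"
    and uT: "universal_for TYPE(('i \<times> 'a) lterm set) V I L F j"
    using assms(3) by (auto simp: free_product_def)
  have T: "in_variety V ?T" and k: "\<forall>i\<in>I. lattice_hom (L i) ?T (?k i)"
    by (rule term_product_in_variety[OF assms(1,2)], assumption)
      (rule ballI, rule term_inj_hom[OF assms(2)], assumption+)
  obtain r where r: "lattice_hom F ?T r" "\<forall>i\<in>I. \<forall>x\<in>carrier (L i). r (j i x) = ?k i x"
    using universal_forE[OF uT T k] .
  obtain s where s: "lattice_hom ?T F s" "\<forall>i\<in>I. \<forall>x\<in>carrier (L i). s (?k i x) = j i x"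
    using universal_forE[OF term_product_universal F j] .
  obtain e where "lattice_hom F F e" "\<forall>i\<in>I. \<forall>x\<in>carrier (L i). e (j i x) = j i x"
    and e: "\<forall>h'. lattice_hom F F h' \<and>
      (\<forall>i\<in>I. \<forall>x\<in>carrier (L i). h' (j i x) = j i x) \<longrightarrow> (\<forall>z\<in>carrier F. h' z = e z)"
    using universal_forE[OF uF F j] .
  have sr: "s (r z) = z" if "z \<in> carrier F" for z
  proof -
    have "id z = e z"
      using F that by (intro e[rule_format] conjI hom_id) (auto simp: in_variety_def)
    moreover have "(s \<circ> r) z = e z"
      using that by (intro e[rule_format] conjI hom_comp[OF r(1) s(1)]) (simp_all add: r(2) s(2))
    ultimately show ?thesis by simp
  qed
  show ?thesis
    unfolding universal_for_def
  proof (intro allI impI)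
    fix N :: "'t gorder" and g
    assume N: "in_variety V N" and g: "\<forall>i\<in>I. lattice_hom (L i) N (g i)"
    obtain h where h: "lattice_hom ?T N h"
        "\<forall>i\<in>I. \<forall>x\<in>carrier (L i). h (?k i x) = g i x"
      and u: "\<forall>h'. lattice_hom ?T N h' \<and>
        (\<forall>i\<in>I. \<forall>x\<in>carrier (L i). h' (?k i x) = g i x) \<longrightarrow> (\<forall>z\<in>carrier ?T. h' z = h z)"
      using universal_forE[OF term_product_universal N g] .
    show "\<exists>h. lattice_hom F N h \<and> (\<forall>i\<in>I. \<forall>x\<in>carrier (L i). h (j i x) = g i x) \<and>
             (\<forall>h'. lattice_hom F N h' \<and> (\<forall>i\<in>I. \<forall>x\<in>carrier (L i). h' (j i x) = g i x)
                   \<longrightarrow> (\<forall>z\<in>carrier F. h' z = h z))"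
    proof (intro exI[of _ "h \<circ> r"] conjI allI impI ballI)
      show "lattice_hom F N (h \<circ> r)" by (rule hom_comp[OF r(1) h(1)])
      show "(h \<circ> r) (j i x) = g i x" if "i \<in> I" "x \<in> carrier (L i)" for i x
        using that by (simp add: r(2) h(2))
      fix h' z
      assume h': "lattice_hom F N h' \<and> (\<forall>i\<in>I. \<forall>x\<in>carrier (L i). h' (j i x) = g i x)"
        and z: "z \<in> carrier F"
      have "r z \<in> carrier ?T" using r(1) z by (auto simp: lattice_hom_def)
      then have "(h' \<circ> s) (r z) = h (r z)"
        using h' by (intro u[rule_format] conjI hom_comp[OF s(1)]) (simp_all add: s(2))
      then show "h' z = (h \<circ> r) z" by (simp add: sr[OF z])
    qed
  qed
qed

end

theory Submission
  imports Defs
begin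

text \<open>
  Adjoining a new bottom and a new top to \<open>L i\<close> gives a lattice \<open>B i\<close> that is again in \<open>V\<close>. Let
  \<open>h\<^sub>0 i\<close> (respectively \<open>h\<^sub>1 i\<close>) be the homomorphism from the free product to \<open>B i\<close> that is the
  identity on \<open>L i\<close> and sends every other factor to the bottom (top). For each \<open>z\<close>, only finitely
  many \<open>h\<^sub>0 i z\<close> differ from the bottom, and only finitely many \<open>h\<^sub>1 i z\<close> from the top. Fix
  \<open>m \<in> M\<close>. Then
  \<open>z \<mapsto> (m \<sqinter> \<Sqinter>\<^sub>i \<phi>\<^sub>i (h\<^sub>1 i z)) \<squnion> \<Squnion>\<^sub>i \<phi>\<^sub>i (h\<^sub>0 i z)\<close>,
  where the indices with an adjoined value are omitted, is isotone: as \<open>z\<close> grows, terms can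
  only disappear from the meet and appear in the join. At \<open>x \<in> L i\<close> it is
  \<open>(m \<sqinter> \<phi>\<^sub>i x) \<squnion> \<phi>\<^sub>i x = \<phi>\<^sub>i x\<close>.
\<close>

section \<open>Homomorphisms, identities and the underlying order\<close>

lemma lattice_homD:
  assumes "lattice_hom A B f"
  shows "Lattice.lattice A" "Lattice.lattice B"
    "x \<in> carrier A \<Longrightarrow> f x \<in> carrier B"
    "x \<in> carrier A \<Longrightarrow> y \<in> carrier A \<Longrightarrow> f (x \<squnion>\<^bsub>A\<^esub> y) = f x \<squnion>\<^bsub>B\<^esub> f y"
    "x \<in> carrier A \<Longrightarrow> y \<in> carrier A \<Longrightarrow> f (x \<sqinter>\<^bsub>A\<^esub> y) = f x \<sqinter>\<^bsub>B\<^esub> f y"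
  using assms unfolding lattice_hom_def join_pres_def meet_pres_def by auto

lemma lattice_hom_isotone: "lattice_hom A B f \<Longrightarrow> isotone A B f"
  unfolding lattice_hom_def by (blast intro: join_pres_isotone)

lemma eval_lterm_hom:
  assumes "lattice_hom A B f" "\<And>n. a n \<in> carrier A"
  shows "eval_lterm B (\<lambda>n. f (a n)) t = f (eval_lterm A a t)"
proof -
  have "eval_lterm A a t \<in> carrier A" for t
    by (rule eval_closed[OF lattice_homD(1)[OF assms(1)]]) (rule assms(2))
  then show ?thesis
    by (induction t) (simp_all add: lattice_homD(4,5)[OF assms(1)])
qed

lemma in_varietyD:
  assumes "in_variety V L" "(s, t) \<in> V" "\<forall>n. a n \<in> carrier L"
  shows "eval_lterm L a s = eval_lterm L a t"
  using assms unfolding in_variety_def by fastforce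

lemma partial_order_imp_weak: "partial_order L \<Longrightarrow> weak_partial_order L"
  by (rule partial_order.axioms)

lemma lattice_imp_partial_order: "Lattice.lattice L \<Longrightarrow> partial_order L"
  unfolding Lattice.lattice_def upper_semilattice_def by blast

section \<open>Adjoining bounds\<close>

text \<open>The bounds are new even if the lattice already has a least or greatest element. A
  homomorphism into the extension can therefore use \<open>Bot\<close> or \<open>Top\<close> as a
  mark that an element gets no value in the lattice itself.\<close>

datatype 'a bounded = Bot | Elem 'a | Top

definition bounded_ext :: "'a gorder \<Rightarrow> 'a bounded gorder" where
  "bounded_ext L =
     \<lparr> carrier = {Bot, Top} \<union> Elem ` carrier L, eq = (=),
       le = (\<lambda>x y. x = Bot \<or> y = Top \<or> (\<exists>a b. x = Elem a \<and> y = Elem b \<and> a \<sqsubseteq>\<^bsub>L\<^esub> b)) \<rparr>"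

lemma carrier_bounded_ext: "carrier (bounded_ext L) = {Bot, Top} \<union> Elem ` carrier L"
  by (simp add: bounded_ext_def)

lemma Elem_in_bounded_ext [simp]: "Elem x \<in> carrier (bounded_ext L) \<longleftrightarrow> x \<in> carrier L"
  by (auto simp: carrier_bounded_ext)

lemma Bot_Top_in_bounded_ext [simp]:
  "Bot \<in> carrier (bounded_ext L)" "Top \<in> carrier (bounded_ext L)"
  by (auto simp: carrier_bounded_ext)

lemma le_bounded_ext [simp]:
  "Bot \<sqsubseteq>\<^bsub>bounded_ext L\<^esub> y" "x \<sqsubseteq>\<^bsub>bounded_ext L\<^esub> Top"
  "x \<sqsubseteq>\<^bsub>bounded_ext L\<^esub> Bot \<longleftrightarrow> x = Bot" "Top \<sqsubseteq>\<^bsub>bounded_ext L\<^esub> y \<longleftrightarrow> y = Top"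
  "Elem a \<sqsubseteq>\<^bsub>bounded_ext L\<^esub> Elem b \<longleftrightarrow> a \<sqsubseteq>\<^bsub>L\<^esub> b"
  by (auto simp: bounded_ext_def)

context
  fixes L :: "'a gorder"
  assumes lat: "Lattice.lattice L"
begin

interpretation L: Lattice.lattice L by (fact lat)

lemma partial_order_bounded_ext: "partial_order (bounded_ext L)"
proof -
  have eq: "(.=\<^bsub>bounded_ext L\<^esub>) = (=)" by (simp add: bounded_ext_def)
  show ?thesis
  proof unfold_locales
    fix x y z
    assume "x \<sqsubseteq>\<^bsub>bounded_ext L\<^esub> y" "y \<sqsubseteq>\<^bsub>bounded_ext L\<^esub> z" and "x \<in> carrier (bounded_ext L)"
      "y \<in> carrier (bounded_ext L)" "z \<in> carrier (bounded_ext L)"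
    then show "x \<sqsubseteq>\<^bsub>bounded_ext L\<^esub> z"
      by (cases x; cases y; cases z) (auto elim!: L.le_trans)
  next
    fix x y
    assume "x \<sqsubseteq>\<^bsub>bounded_ext L\<^esub> y" "y \<sqsubseteq>\<^bsub>bounded_ext L\<^esub> x" and "x \<in> carrier (bounded_ext L)"
      "y \<in> carrier (bounded_ext L)"
    then show "x .=\<^bsub>bounded_ext L\<^esub> y"
      by (cases x; cases y) (auto simp: eq intro: L.le_antisym)
  next
    fix x assume "x \<in> carrier (bounded_ext L)"
    then show "x \<sqsubseteq>\<^bsub>bounded_ext L\<^esub> x" by (cases x) auto
  qed (auto simp: eq)
qed

lemma lattice_bounded_ext: "Lattice.lattice (bounded_ext L)"
proof -
  interpret partial_order "bounded_ext L" by (fact partial_order_bounded_ext)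
  show ?thesis
  proof unfold_locales
    fix x y assume xy: "x \<in> carrier (bounded_ext L)" "y \<in> carrier (bounded_ext L)"
    \<comment> \<open>Pairs containing \<open>Bot\<close> are caught before the last clause, so the
      pairs that reach it contain \<open>Top\<close>. The definition of \<open>k\<close> below is
      dual.\<close>
    define j where "j = (case (x, y) of (Elem a, Elem b) \<Rightarrow> Elem (a \<squnion>\<^bsub>L\<^esub> b)
      | (Bot, _) \<Rightarrow> y | (_, Bot) \<Rightarrow> x | _ \<Rightarrow> Top)"
    have "least (bounded_ext L) j (Upper (bounded_ext L) {x, y})"
    proof (rule least_UpperI)
      show "z \<sqsubseteq>\<^bsub>bounded_ext L\<^esub> j" if "z \<in> {x, y}" for z
        using that xy by (cases x; cases y) (auto simp: j_def L.join_left L.join_right)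
      show "j \<sqsubseteq>\<^bsub>bounded_ext L\<^esub> z" if "z \<in> Upper (bounded_ext L) {x, y}" for z
        using that xy
        by (cases x; cases y; cases z) (auto simp: j_def Upper_def intro: L.join_le)
    qed (use xy in \<open>auto simp: j_def split: bounded.split\<close>)
    then show "\<exists>s. least (bounded_ext L) s (Upper (bounded_ext L) {x, y})" by blast
    define k where "k = (case (x, y) of (Elem a, Elem b) \<Rightarrow> Elem (a \<sqinter>\<^bsub>L\<^esub> b)
      | (Top, _) \<Rightarrow> y | (_, Top) \<Rightarrow> x | _ \<Rightarrow> Bot)"
    have "greatest (bounded_ext L) k (Lower (bounded_ext L) {x, y})"
    proof (rule greatest_LowerI)
      show "k \<sqsubseteq>\<^bsub>bounded_ext L\<^esub> z" if "z \<in> {x, y}" for z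
        using that xy by (cases x; cases y) (auto simp: k_def L.meet_left L.meet_right)
      show "z \<sqsubseteq>\<^bsub>bounded_ext L\<^esub> k" if "z \<in> Lower (bounded_ext L) {x, y}" for z
        using that xy
        by (cases x; cases y; cases z) (auto simp: k_def Lower_def intro: L.meet_le)
    qed (use xy in \<open>auto simp: k_def split: bounded.split\<close>)
    then show "\<exists>s. greatest (bounded_ext L) s (Lower (bounded_ext L) {x, y})" by blast
  qed
qed

lemma join_bounded_ext [simp]:
  "b \<in> carrier (bounded_ext L) \<Longrightarrow> Bot \<squnion>\<^bsub>bounded_ext L\<^esub> b = b"
  "b \<in> carrier (bounded_ext L) \<Longrightarrow> b \<squnion>\<^bsub>bounded_ext L\<^esub> Bot = b"
  "b \<in> carrier (bounded_ext L) \<Longrightarrow> Top \<squnion>\<^bsub>bounded_ext L\<^esub> b = Top"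
  "b \<in> carrier (bounded_ext L) \<Longrightarrow> b \<squnion>\<^bsub>bounded_ext L\<^esub> Top = Top"
  "x \<in> carrier L \<Longrightarrow> y \<in> carrier L \<Longrightarrow>
     Elem x \<squnion>\<^bsub>bounded_ext L\<^esub> Elem y = Elem (x \<squnion>\<^bsub>L\<^esub> y)"
proof -
  interpret B: Lattice.lattice "bounded_ext L" by (fact lattice_bounded_ext)
  show "b \<in> carrier (bounded_ext L) \<Longrightarrow> Bot \<squnion>\<^bsub>bounded_ext L\<^esub> b = b"
    "b \<in> carrier (bounded_ext L) \<Longrightarrow> b \<squnion>\<^bsub>bounded_ext L\<^esub> Bot = b"
    "b \<in> carrier (bounded_ext L) \<Longrightarrow> Top \<squnion>\<^bsub>bounded_ext L\<^esub> b = Top"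
    "b \<in> carrier (bounded_ext L) \<Longrightarrow> b \<squnion>\<^bsub>bounded_ext L\<^esub> Top = Top"
    by (rule join_eqI[OF lattice_bounded_ext]; simp)+
  assume xy: "x \<in> carrier L" "y \<in> carrier L"
  show "Elem x \<squnion>\<^bsub>bounded_ext L\<^esub> Elem y = Elem (x \<squnion>\<^bsub>L\<^esub> y)"
  proof (rule join_eqI[OF lattice_bounded_ext])
    fix w assume "w \<in> carrier (bounded_ext L)" "Elem x \<sqsubseteq>\<^bsub>bounded_ext L\<^esub> w"
      "Elem y \<sqsubseteq>\<^bsub>bounded_ext L\<^esub> w"
    then show "Elem (x \<squnion>\<^bsub>L\<^esub> y) \<sqsubseteq>\<^bsub>bounded_ext L\<^esub> w"
      using xy by (cases w) (auto intro: L.join_le)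
  qed (use xy in \<open>auto simp: L.join_left L.join_right\<close>)
qed

lemma meet_bounded_ext [simp]:
  "b \<in> carrier (bounded_ext L) \<Longrightarrow> Bot \<sqinter>\<^bsub>bounded_ext L\<^esub> b = Bot"
  "b \<in> carrier (bounded_ext L) \<Longrightarrow> b \<sqinter>\<^bsub>bounded_ext L\<^esub> Bot = Bot"
  "b \<in> carrier (bounded_ext L) \<Longrightarrow> Top \<sqinter>\<^bsub>bounded_ext L\<^esub> b = b"
  "b \<in> carrier (bounded_ext L) \<Longrightarrow> b \<sqinter>\<^bsub>bounded_ext L\<^esub> Top = b"
  "x \<in> carrier L \<Longrightarrow> y \<in> carrier L \<Longrightarrow>
     Elem x \<sqinter>\<^bsub>bounded_ext L\<^esub> Elem y = Elem (x \<sqinter>\<^bsub>L\<^esub> y)"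
proof -
  interpret B: Lattice.lattice "bounded_ext L" by (fact lattice_bounded_ext)
  show "b \<in> carrier (bounded_ext L) \<Longrightarrow> Bot \<sqinter>\<^bsub>bounded_ext L\<^esub> b = Bot"
    "b \<in> carrier (bounded_ext L) \<Longrightarrow> b \<sqinter>\<^bsub>bounded_ext L\<^esub> Bot = Bot"
    "b \<in> carrier (bounded_ext L) \<Longrightarrow> Top \<sqinter>\<^bsub>bounded_ext L\<^esub> b = b"
    "b \<in> carrier (bounded_ext L) \<Longrightarrow> b \<sqinter>\<^bsub>bounded_ext L\<^esub> Top = b"
    by (rule meet_eqI[OF lattice_bounded_ext]; simp)+
  assume xy: "x \<in> carrier L" "y \<in> carrier L"
  show "Elem x \<sqinter>\<^bsub>bounded_ext L\<^esub> Elem y = Elem (x \<sqinter>\<^bsub>L\<^esub> y)"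
  proof (rule meet_eqI[OF lattice_bounded_ext])
    fix w assume "w \<in> carrier (bounded_ext L)" "w \<sqsubseteq>\<^bsub>bounded_ext L\<^esub> Elem x"
      "w \<sqsubseteq>\<^bsub>bounded_ext L\<^esub> Elem y"
    then show "w \<sqsubseteq>\<^bsub>bounded_ext L\<^esub> Elem (x \<sqinter>\<^bsub>L\<^esub> y)"
      using xy by (cases w) (auto intro: L.meet_le)
  qed (use xy in \<open>auto simp: L.meet_left L.meet_right\<close>)
qed

section \<open>Homomorphisms and identities on the bounded extension\<close>

lemma Elem_hom: "lattice_hom L (bounded_ext L) Elem"
  using lat lattice_bounded_ext by (simp add: lattice_hom_def join_pres_def meet_pres_def)

text \<open>Splitting off \<open>Top\<close> alone (\<open>c = p\<close>) or \<open>Bot\<close>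
  alone (\<open>c = q\<close>) cuts the extension into an ideal and the complementary filter.
  Sending the ideal to \<open>p\<close> and the filter to \<open>q\<close> then respects joins and
  meets.\<close>

lemma collapse_hom:
  assumes N: "Lattice.lattice N" and pq: "p \<in> carrier N" "q \<in> carrier N" "p \<sqsubseteq>\<^bsub>N\<^esub> q"
    and c: "c \<in> {p, q}"
  shows "lattice_hom (bounded_ext L) N (case_bounded p (\<lambda>_. c) q)"
proof -
  interpret N: Lattice.lattice N by (fact N)
  have [simp]: "p \<squnion>\<^bsub>N\<^esub> p = p" "q \<squnion>\<^bsub>N\<^esub> q = q" "p \<squnion>\<^bsub>N\<^esub> q = q" "q \<squnion>\<^bsub>N\<^esub> p = q"
    by (rule join_eqI[OF N]; use pq in simp)+
  have [simp]: "p \<sqinter>\<^bsub>N\<^esub> p = p" "q \<sqinter>\<^bsub>N\<^esub> q = q" "p \<sqinter>\<^bsub>N\<^esub> q = p" "q \<sqinter>\<^bsub>N\<^esub> p = p"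
    by (rule meet_eqI[OF N]; use pq in simp)+
  show ?thesis
    using lattice_bounded_ext N pq c
    by (auto simp: lattice_hom_def join_pres_def meet_pres_def carrier_bounded_ext)
qed

text \<open>On the whole extension \<theta> need not be a homomorphism, since \<open>y\<close> and
  \<open>w\<close> need not bound \<open>L\<close>. On \<open>C\<close> they do bound all values
  from \<open>L\<close>, so they behave under join and meet just as \<open>Bot\<close> and
  \<open>Top\<close> do. As \<open>C\<close> is closed under both operations, evaluation inside
  \<open>C\<close> is carried by \<theta> to evaluation in \<open>L\<close>.\<close>

lemma eval_bounded_ext_interval:
  fixes y w
  defines "C \<equiv> {Bot, Top} \<union> Elem ` {x \<in> carrier L. y \<sqsubseteq>\<^bsub>L\<^esub> x \<and> x \<sqsubseteq>\<^bsub>L\<^esub> w}"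
    and "\<theta> \<equiv> case_bounded y (\<lambda>x. x) w"
  assumes yw: "y \<in> carrier L" "w \<in> carrier L" "y \<sqsubseteq>\<^bsub>L\<^esub> w"
    and "\<And>v. v \<in> set_lterm t \<Longrightarrow> a v \<in> C"
  shows "eval_lterm (bounded_ext L) a t \<in> C \<and>
    eval_lterm L (\<lambda>v. \<theta> (a v)) t = \<theta> (eval_lterm (bounded_ext L) a t)"
proof -
  have C: "x \<in> carrier (bounded_ext L)" if "x \<in> C" for x
    using that by (auto simp: C_def)
  have \<theta>: "\<theta> x \<in> carrier L" "y \<sqsubseteq>\<^bsub>L\<^esub> \<theta> x" "\<theta> x \<sqsubseteq>\<^bsub>L\<^esub> w" if "x \<in> C" for x
    using that yw by (auto simp: C_def \<theta>_def)
  have j: "x \<squnion>\<^bsub>bounded_ext L\<^esub> x' \<in> C \<and>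
      \<theta> x \<squnion>\<^bsub>L\<^esub> \<theta> x' = \<theta> (x \<squnion>\<^bsub>bounded_ext L\<^esub> x')" if xx: "x \<in> C" "x' \<in> C" for x x'
  proof -
    have jy: "y \<squnion>\<^bsub>L\<^esub> \<theta> z = \<theta> z" "\<theta> z \<squnion>\<^bsub>L\<^esub> y = \<theta> z"
      "w \<squnion>\<^bsub>L\<^esub> \<theta> z = w" "\<theta> z \<squnion>\<^bsub>L\<^esub> w = w" if "z \<in> C" for z
      by (rule join_eqI[OF lat]; use \<theta>[OF that] yw in simp)+
    have [simp]: "\<theta> Bot = y" "\<theta> Top = w" "\<theta> (Elem u) = u" for u
      by (simp_all add: \<theta>_def)
    show ?thesis
    proof (cases "x \<in> {Bot, Top} \<or> x' \<in> {Bot, Top}")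
      case True
      with xx jy[OF xx(1)] jy[OF xx(2)] C[OF xx(1)] C[OF xx(2)] show ?thesis
        by (auto simp: C_def)
    next
      case False
      with xx obtain u u' where u: "x = Elem u" "x' = Elem u'" "u \<in> carrier L" "u' \<in> carrier L"
        "y \<sqsubseteq>\<^bsub>L\<^esub> u" "u \<sqsubseteq>\<^bsub>L\<^esub> w" "u' \<sqsubseteq>\<^bsub>L\<^esub> w" by (auto simp: C_def)
      have "y \<sqsubseteq>\<^bsub>L\<^esub> u \<squnion>\<^bsub>L\<^esub> u'"
        using u yw by (intro L.le_trans[OF u(5) L.join_left]) auto
      with u yw show ?thesis by (auto simp: C_def intro: L.join_le)
    qed
  qed
  have m: "x \<sqinter>\<^bsub>bounded_ext L\<^esub> x' \<in> C \<and>
      \<theta> x \<sqinter>\<^bsub>L\<^esub> \<theta> x' = \<theta> (x \<sqinter>\<^bsub>bounded_ext L\<^esub> x')" if xx: "x \<in> C" "x' \<in> C" for x x'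
  proof -
    have my: "y \<sqinter>\<^bsub>L\<^esub> \<theta> z = y" "\<theta> z \<sqinter>\<^bsub>L\<^esub> y = y"
      "w \<sqinter>\<^bsub>L\<^esub> \<theta> z = \<theta> z" "\<theta> z \<sqinter>\<^bsub>L\<^esub> w = \<theta> z" if "z \<in> C" for z
      by (rule meet_eqI[OF lat]; use \<theta>[OF that] yw in simp)+
    have [simp]: "\<theta> Bot = y" "\<theta> Top = w" "\<theta> (Elem u) = u" for u
      by (simp_all add: \<theta>_def)
    show ?thesis
    proof (cases "x \<in> {Bot, Top} \<or> x' \<in> {Bot, Top}")
      case True
      with xx my[OF xx(1)] my[OF xx(2)] C[OF xx(1)] C[OF xx(2)] show ?thesis
        by (auto simp: C_def)
    next
      case False
      with xx obtain u u' where u: "x = Elem u" "x' = Elem u'" "u \<in> carrier L" "u' \<in> carrier L"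
        "u \<sqsubseteq>\<^bsub>L\<^esub> w" "y \<sqsubseteq>\<^bsub>L\<^esub> u" "y \<sqsubseteq>\<^bsub>L\<^esub> u'" by (auto simp: C_def)
      have "u \<sqinter>\<^bsub>L\<^esub> u' \<sqsubseteq>\<^bsub>L\<^esub> w"
        using u yw by (intro L.le_trans[OF L.meet_left u(5)]) auto
      with u yw show ?thesis by (auto simp: C_def intro: L.meet_le)
    qed
  qed
  show ?thesis
    using assms(6) by (induction t) (simp_all add: j m)
qed

lemma finite_subset_interval:
  assumes "finite A" "A \<subseteq> carrier L" "c \<in> carrier L"
  obtains y w where "y \<in> carrier L" "w \<in> carrier L" "y \<sqsubseteq>\<^bsub>L\<^esub> w"
    "\<And>x. x \<in> A \<Longrightarrow> y \<sqsubseteq>\<^bsub>L\<^esub> x \<and> x \<sqsubseteq>\<^bsub>L\<^esub> w"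
proof -
  \<comment> \<open>The point \<open>c\<close> covers the case of empty \<open>A\<close>, whose join
    and meet need not exist in \<open>L\<close>.\<close>
  let ?A = "insert c A"
  have A: "finite ?A" "?A \<subseteq> carrier L" "?A \<noteq> {}" using assms by auto
  note s = L.finite_sup_least[OF A] and i = L.finite_inf_greatest[OF A]
  have 1: "\<Sqinter>\<^bsub>L\<^esub>?A \<sqsubseteq>\<^bsub>L\<^esub> x" "x \<sqsubseteq>\<^bsub>L\<^esub> \<Squnion>\<^bsub>L\<^esub>?A" if "x \<in> ?A" for x
    using greatest_Lower_below[OF i that A(2)] least_Upper_above[OF s that A(2)] by auto
  have 2: "\<Sqinter>\<^bsub>L\<^esub>?A \<in> carrier L" "\<Squnion>\<^bsub>L\<^esub>?A \<in> carrier L" using A by simp_all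
  have "\<Sqinter>\<^bsub>L\<^esub>?A \<sqsubseteq>\<^bsub>L\<^esub> \<Squnion>\<^bsub>L\<^esub>?A"
    by (rule L.le_trans[OF 1(1)[of c] 1(2)[of c] 2(1) assms(3) 2(2)]) simp_all
  then show thesis using 1 2 by (intro that[of "\<Sqinter>\<^bsub>L\<^esub>?A" "\<Squnion>\<^bsub>L\<^esub>?A"]) auto
qed

end

text \<open>
  A two-element chain in \<open>V\<close> tests whether the two sides of an identity are both \<open>Bot\<close> or both
  \<open>Top\<close>. If they are not, all variables that are \<open>Bot\<close> or \<open>Top\<close> can be replaced by elements of
  \<open>L\<close> below or above the values of the other variables.
\<close>

lemma in_variety_bounded_ext:
  assumes "nontrivial_variety TYPE('w) V" "in_variety V L"
  shows "in_variety V (bounded_ext L)"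
proof -
  have lat: "Lattice.lattice L" using assms(2) by (simp add: in_variety_def)
  obtain W :: "'w gorder" and x y where W: "in_variety V W"
    and xy: "x \<in> carrier W" "y \<in> carrier W" "x \<noteq> y"
    using assms(1) unfolding nontrivial_variety_def by blast
  interpret W: Lattice.lattice W using W by (simp add: in_variety_def)
  define p q where "p = x \<sqinter>\<^bsub>W\<^esub> y" and "q = x \<squnion>\<^bsub>W\<^esub> y"
  have mem: "p \<in> carrier W" "q \<in> carrier W" using xy by (auto simp: p_def q_def)
  have le: "p \<sqsubseteq>\<^bsub>W\<^esub> x" "x \<sqsubseteq>\<^bsub>W\<^esub> q" "p \<sqsubseteq>\<^bsub>W\<^esub> y" "y \<sqsubseteq>\<^bsub>W\<^esub> q"
    using xy by (auto simp: p_def q_def W.meet_left W.meet_right W.join_left W.join_right)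
  have pq: "p \<sqsubseteq>\<^bsub>W\<^esub> q" using le mem xy W.le_trans by blast
  have ne: "p \<noteq> q"
  proof
    assume "p = q"
    with le mem xy have "x = p" "y = p" by (auto intro: W.le_antisym)
    with xy show False by simp
  qed
  have "eval_lterm (bounded_ext L) a s = eval_lterm (bounded_ext L) a t"
    if st: "(s, t) \<in> V" and a: "\<And>n. a n \<in> carrier (bounded_ext L)" for s t a
  proof -
    have cl: "eval_lterm (bounded_ext L) a u \<in> carrier (bounded_ext L)" for u
      by (rule eval_closed[OF lattice_bounded_ext[OF lat]]) (rule a)
    \<comment> \<open>The collapse carries both sides to values of \<open>s\<close> and
      \<open>t\<close> in \<open>W\<close>, which satisfies the identity.\<close>
    have coll: "case_bounded p (\<lambda>_. c) q (eval_lterm (bounded_ext L) a s) =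
        case_bounded p (\<lambda>_. c) q (eval_lterm (bounded_ext L) a t)" if "c \<in> {p, q}" for c
    proof -
      note h = collapse_hom[OF lat W.lattice_axioms mem pq that]
      have "\<forall>n. case_bounded p (\<lambda>_. c) q (a n) \<in> carrier W"
        using lattice_homD(3)[OF h a] by blast
      with W st show ?thesis
        unfolding eval_lterm_hom[OF h a, symmetric] by (intro in_varietyD)
    qed
    \<comment> \<open>For \<open>c = q\<close> only \<open>Bot\<close> is sent to \<open>p\<close>,
      and for \<open>c = p\<close> only \<open>Top\<close> is sent to \<open>q\<close>. As
      \<open>p\<close> and \<open>q\<close> differ, equal images decide both equivalences.\<close>
    have bot: "eval_lterm (bounded_ext L) a s = Bot \<longleftrightarrow> eval_lterm (bounded_ext L) a t = Bot"
      using coll[of q] ne by (auto split: bounded.splits)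
    have top: "eval_lterm (bounded_ext L) a s = Top \<longleftrightarrow> eval_lterm (bounded_ext L) a t = Top"
      using coll[of p] ne by (auto split: bounded.splits)
    \<comment> \<open>These are the values from \<open>L\<close> taken by the variables of the two
      terms. There are finitely many, so they lie in an interval of \<open>L\<close>.\<close>
    define A where "A = {x. Elem x \<in> a ` (set_lterm s \<union> set_lterm t)}"
    have finl: "finite (set_lterm u)" for u :: "nat lterm" by (induction u) auto
    have "finite (Elem -` (a ` (set_lterm s \<union> set_lterm t)))"
      by (rule finite_vimageI) (auto simp: finl inj_def)
    then have A: "finite A" by (simp add: A_def vimage_def)
    have "A \<subseteq> carrier L"
    proof
      fix x assume "x \<in> A"
      then obtain n where "Elem x = a n" by (auto simp: A_def)
      then show "x \<in> carrier L" using a[of n] by (metis Elem_in_bounded_ext)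
    qed
    moreover obtain c where "c \<in> carrier L" using assms(2) by (auto simp: in_variety_def)
    ultimately obtain l w where lw: "l \<in> carrier L" "w \<in> carrier L" "l \<sqsubseteq>\<^bsub>L\<^esub> w"
      and b: "\<And>x. x \<in> A \<Longrightarrow> l \<sqsubseteq>\<^bsub>L\<^esub> x \<and> x \<sqsubseteq>\<^bsub>L\<^esub> w"
      using finite_subset_interval[OF lat A] by blast
    define \<theta> where "\<theta> = case_bounded l (\<lambda>x. x) w"
    have aC: "a v \<in> {Bot, Top} \<union> Elem ` {x \<in> carrier L. l \<sqsubseteq>\<^bsub>L\<^esub> x \<and> x \<sqsubseteq>\<^bsub>L\<^esub> w}"
      if "v \<in> set_lterm s \<union> set_lterm t" for v
    proof (cases "a v")
      case (Elem x)
      then have "x \<in> A" using that by (force simp: A_def)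
      with b[OF this] a[of v] Elem show ?thesis by auto
    qed auto
    have "eval_lterm L (\<lambda>v. \<theta> (a v)) u = \<theta> (eval_lterm (bounded_ext L) a u)"
      if "u \<in> {s, t}" for u
      unfolding \<theta>_def
      by (rule conjunct2[OF eval_bounded_ext_interval[OF lat lw]], rule aC) (use that in auto)
    moreover have "\<theta> (a v) \<in> carrier L" for v
      using a[of v] lw by (auto simp: \<theta>_def carrier_bounded_ext)
    then have "eval_lterm L (\<lambda>v. \<theta> (a v)) s = eval_lterm L (\<lambda>v. \<theta> (a v)) t"
      using assms(2) st by (intro in_varietyD) auto
    ultimately have "\<theta> (eval_lterm (bounded_ext L) a s) = \<theta> (eval_lterm (bounded_ext L) a t)"
      by simp
    \<comment> \<open>Either both sides are the same bound, or both have the form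
      \<open>Elem x\<close>, and there \<theta> is injective.\<close>
    with bot top show ?thesis
      by (cases "eval_lterm (bounded_ext L) a s"; cases "eval_lterm (bounded_ext L) a t")
        (auto simp: \<theta>_def)
  qed
  then show ?thesis
    using lattice_bounded_ext[OF lat] Bot_Top_in_bounded_ext unfolding in_variety_def by blast
qed

section \<open>Covers in a free product\<close>

text \<open>The term product is generated by the images of its factors: each element is the class of
  a term over them. The rule turns induction on terms into one that no longer mentions
  terms.\<close>

lemma term_product_induct [consumes 1, case_names Var Meet Join]:
  assumes "z \<in> carrier (term_product V I L)"
    and "\<And>i x. i \<in> I \<Longrightarrow> x \<in> carrier (L i) \<Longrightarrow> P (term_inj V I L i x)"
    and "\<And>u v. u \<in> carrier (term_product V I L) \<Longrightarrow> v \<in> carrier (term_product V I L) \<Longrightarrow>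
      P u \<Longrightarrow> P v \<Longrightarrow> P (u \<sqinter>\<^bsub>term_product V I L\<^esub> v)"
    and "\<And>u v. u \<in> carrier (term_product V I L) \<Longrightarrow> v \<in> carrier (term_product V I L) \<Longrightarrow>
      P u \<Longrightarrow> P v \<Longrightarrow> P (u \<squnion>\<^bsub>term_product V I L\<^esub> v)"
  shows "P z"
proof -
  have "P (fpcls V I L t)" if "t \<in> fpterms I L" for t
    using that
  proof (induction t)
    case (LVar v)
    then show ?case using assms(2) by (cases v) (simp add: term_inj_def)
  next
    case (LMeet s t)
    then show ?case
      using assms(3)[of "fpcls V I L s" "fpcls V I L t"]
      by (simp add: carrier_term_product meet_term_product)
  next
    case (LJoin s t)
    then show ?case
      using assms(4)[of "fpcls V I L s" "fpcls V I L t"]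
      by (simp add: carrier_term_product join_term_product)
  qed
  then show ?thesis using assms(1) by (auto simp: carrier_term_product)
qed

text \<open>Take the embedding \<open>Elem\<close> on \<open>L i\<close> and the constant
  \<open>b\<close> on every other factor; constants are homomorphisms because \<open>b\<close> is
  idempotent. Nontriviality puts the extension of \<open>L i\<close> into the variety, so the
  universal property applies to this family.\<close>

lemma cover_hom_exists:
  fixes L :: "'i \<Rightarrow> 'a gorder"
  assumes nt: "nontrivial_variety TYPE('w) V" and L: "\<And>i. i \<in> I \<Longrightarrow> in_variety V (L i)"
    and i: "i \<in> I" and b: "b \<in> {Bot, Top}"
  shows "\<exists>h. lattice_hom (term_product V I L) (bounded_ext (L i)) h \<and>
    (\<forall>k\<in>I. \<forall>x\<in>carrier (L k). h (term_inj V I L k x) = (if k = i then Elem x else b))"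
proof -
  have lat: "Lattice.lattice (L k)" if "k \<in> I" for k
    using L[OF that] by (simp add: in_variety_def)
  have "lattice_hom (L k) (bounded_ext (L i)) (\<lambda>x. if k = i then Elem x else b)"
    if k: "k \<in> I" for k
  proof (cases "k = i")
    case True
    then show ?thesis using Elem_hom[OF lat[OF i]] by simp
  next
    case False
    then show ?thesis
      using b lat[OF k] lattice_bounded_ext[OF lat[OF i]] lat[OF i]
      by (auto simp: lattice_hom_def join_pres_def meet_pres_def)
  qed
  then have "\<forall>k\<in>I. lattice_hom (L k) (bounded_ext (L i)) (\<lambda>x. if k = i then Elem x else b)"
    by blast
  from universal_forE[OF term_product_universal in_variety_bounded_ext[OF nt L[OF i]] this]
  show ?thesis by metis
qed

text \<open>Both claims follow by induction over generation by the factors. The elements of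
  \<open>L i\<close> together with one bound \<open>b\<close> form a sublattice of the extension. A
  generator has a value other than \<open>b\<close> at only one index, and if \<open>u\<close> and
  \<open>v\<close> both have value \<open>b\<close> at an index, so do their join and meet; hence
  the exceptional indices of a compound lie in the union of those of its parts.\<close>

lemma cover_hom_values:
  fixes L :: "'i \<Rightarrow> 'a gorder"
  assumes L: "\<And>i. i \<in> I \<Longrightarrow> in_variety V (L i)" and b: "b \<in> {Bot, Top}"
    and h: "\<And>i. i \<in> I \<Longrightarrow> lattice_hom (term_product V I L) (bounded_ext (L i)) (h i)"
    and hv: "\<And>i k x. i \<in> I \<Longrightarrow> k \<in> I \<Longrightarrow> x \<in> carrier (L k) \<Longrightarrow>
      h i (term_inj V I L k x) = (if k = i then Elem x else b)"
    and z: "z \<in> carrier (term_product V I L)"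
  shows "finite {i \<in> I. h i z \<noteq> b}" and "\<forall>i\<in>I. h i z \<in> insert b (Elem ` carrier (L i))"
proof -
  have lat: "Lattice.lattice (L k)" if "k \<in> I" for k
    using L[OF that] by (simp add: in_variety_def)
  have cl: "h i u \<in> carrier (bounded_ext (L i))"
    if "i \<in> I" "u \<in> carrier (term_product V I L)" for i u
    using lattice_homD(3)[OF h] that .
  note hj = lattice_homD(4)[OF h] and hm = lattice_homD(5)[OF h]
  have closed: "x \<squnion>\<^bsub>L i\<^esub> y \<in> carrier (L i)" "x \<sqinter>\<^bsub>L i\<^esub> y \<in> carrier (L i)"
    if "i \<in> I" "x \<in> carrier (L i)" "y \<in> carrier (L i)" for i x y
  proof -
    interpret Lattice.lattice "L i" by (rule lat) fact
    show "x \<squnion>\<^bsub>L i\<^esub> y \<in> carrier (L i)" "x \<sqinter>\<^bsub>L i\<^esub> y \<in> carrier (L i)" using that by auto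
  qed
  show "\<forall>i\<in>I. h i z \<in> insert b (Elem ` carrier (L i))"
    using z
  proof (induction rule: term_product_induct)
    case (Var i x)
    then show ?case by (simp add: hv)
  next
    case (Meet u v)
    then show ?case using b by (fastforce simp: hm lat closed)
  next
    case (Join u v)
    then show ?case using b by (fastforce simp: hj lat closed)
  qed
  show "finite {i \<in> I. h i z \<noteq> b}"
    using z
  proof (induction rule: term_product_induct)
    case (Var i x)
    have "{k \<in> I. h k (term_inj V I L i x) \<noteq> b} \<subseteq> {i}" using Var by (auto simp: hv split: if_splits)
    then show ?case by (rule finite_subset) simp
  next
    case (Meet u v)
    have "{i \<in> I. h i (u \<sqinter>\<^bsub>term_product V I L\<^esub> v) \<noteq> b} \<subseteq>
        {i \<in> I. h i u \<noteq> b} \<union> {i \<in> I. h i v \<noteq> b}"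
      using Meet(1,2) b by (auto simp: hm lat cl)
    then show ?case by (rule finite_subset) (simp add: Meet)
  next
    case (Join u v)
    have "{i \<in> I. h i (u \<squnion>\<^bsub>term_product V I L\<^esub> v) \<noteq> b} \<subseteq>
        {i \<in> I. h i u \<noteq> b} \<union> {i \<in> I. h i v \<noteq> b}"
      using Join(1,2) b by (auto simp: hj lat cl)
    then show ?case by (rule finite_subset) (simp add: Join)
  qed
qed

text \<open>Keeping \<open>b\<close> arbitrary serves both families of the construction:
  \<open>Bot\<close> yields \<open>h0\<close> and \<open>Top\<close> yields
  \<open>h1\<close>.\<close>

lemma cover_homs:
  fixes L :: "'i \<Rightarrow> 'a gorder"
  assumes nt: "nontrivial_variety TYPE('w) V" and L: "\<And>i. i \<in> I \<Longrightarrow> in_variety V (L i)"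
    and b: "b \<in> {Bot, Top}"
  shows "\<exists>h. (\<forall>i\<in>I. lattice_hom (term_product V I L) (bounded_ext (L i)) (h i)) \<and>
    (\<forall>i\<in>I. \<forall>k\<in>I. \<forall>x\<in>carrier (L k).
       h i (term_inj V I L k x) = (if k = i then Elem x else b)) \<and>
    (\<forall>z\<in>carrier (term_product V I L). finite {i \<in> I. h i z \<noteq> b}) \<and>
    (\<forall>z\<in>carrier (term_product V I L). \<forall>i\<in>I. h i z \<in> insert b (Elem ` carrier (L i)))"
proof -
  have "\<forall>i\<in>I. \<exists>h. lattice_hom (term_product V I L) (bounded_ext (L i)) h \<and>
      (\<forall>k\<in>I. \<forall>x\<in>carrier (L k). h (term_inj V I L k x) = (if k = i then Elem x else b))"
    by (intro ballI cover_hom_exists[OF nt] L b)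
  from bchoice[OF this] obtain h where *: "\<forall>i\<in>I.
      lattice_hom (term_product V I L) (bounded_ext (L i)) (h i) \<and>
      (\<forall>k\<in>I. \<forall>x\<in>carrier (L k). h i (term_inj V I L k x) = (if k = i then Elem x else b))"
    by (rule exE)
  then have h: "\<And>i. i \<in> I \<Longrightarrow> lattice_hom (term_product V I L) (bounded_ext (L i)) (h i)"
    "\<And>i k x. i \<in> I \<Longrightarrow> k \<in> I \<Longrightarrow> x \<in> carrier (L k) \<Longrightarrow>
      h i (term_inj V I L k x) = (if k = i then Elem x else b)"
    by simp_all
  note v = cover_hom_values[OF L b h]
  show ?thesis
    by (intro exI[of _ h] conjI ballI) (simp_all only: h v)
qed

section \<open>The isotone extension\<close>

lemma (in Lattice.lattice) finite_Sup_le_iff: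
  assumes "finite A" "A \<subseteq> carrier L" "A \<noteq> {}" "x \<in> carrier L"
  shows "\<Squnion>A \<sqsubseteq> x \<longleftrightarrow> (\<forall>a\<in>A. a \<sqsubseteq> x)"
proof -
  note s = finite_sup_least[OF assms(1-3)]
  have "\<And>a. a \<in> A \<Longrightarrow> a \<sqsubseteq> \<Squnion>A" using least_Upper_above[OF s _ assms(2)] .
  moreover have "\<Squnion>A \<in> carrier L" using assms by simp
  ultimately have "\<Squnion>A \<sqsubseteq> x \<Longrightarrow> a \<in> A \<Longrightarrow> a \<sqsubseteq> x" for a
    using assms(2,4) by (meson le_trans subsetD)
  moreover have "\<Squnion>A \<sqsubseteq> x" if "\<forall>a\<in>A. a \<sqsubseteq> x"
    by (rule least_le[OF s]) (use that assms in \<open>auto simp: Upper_def\<close>)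
  ultimately show ?thesis by blast
qed

lemma (in Lattice.lattice) le_finite_Inf_iff:
  assumes "finite A" "A \<subseteq> carrier L" "A \<noteq> {}" "x \<in> carrier L"
  shows "x \<sqsubseteq> \<Sqinter>A \<longleftrightarrow> (\<forall>a\<in>A. x \<sqsubseteq> a)"
proof -
  note s = finite_inf_greatest[OF assms(1-3)]
  have "\<And>a. a \<in> A \<Longrightarrow> \<Sqinter>A \<sqsubseteq> a" using greatest_Lower_below[OF s _ assms(2)] .
  moreover have "\<Sqinter>A \<in> carrier L" using assms by simp
  ultimately have "x \<sqsubseteq> \<Sqinter>A \<Longrightarrow> a \<in> A \<Longrightarrow> x \<sqsubseteq> a" for a
    using assms(2,4) by (meson le_trans subsetD)
  moreover have "x \<sqsubseteq> \<Sqinter>A" if "\<forall>a\<in>A. x \<sqsubseteq> a"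
    by (rule greatest_le[OF s]) (use that assms in \<open>auto simp: Lower_def\<close>)
  ultimately show ?thesis by blast
qed

text \<open>Domination is assumed instead of inclusion because, as the argument of the extension
  grows, terms of the join are replaced by larger ones and new ones appear.\<close>

lemma (in Lattice.lattice) finite_Sup_mono:
  assumes "finite A" "A \<subseteq> carrier L" "A \<noteq> {}" "finite B" "B \<subseteq> carrier L"
    and "\<And>a. a \<in> A \<Longrightarrow> \<exists>b\<in>B. a \<sqsubseteq> b"
  shows "\<Squnion>A \<sqsubseteq> \<Squnion>B"
proof -
  have B: "B \<noteq> {}" using assms by blast
  then have c: "\<Squnion>B \<in> carrier L" using assms by simp
  have "\<forall>b\<in>B. b \<sqsubseteq> \<Squnion>B" using finite_Sup_le_iff[OF assms(4,5) B c] c by simp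
  then show ?thesis
    using finite_Sup_le_iff[OF assms(1-3) c] assms c by (meson le_trans subsetD)
qed

lemma (in Lattice.lattice) finite_Inf_mono:
  assumes "finite A" "A \<subseteq> carrier L" "A \<noteq> {}" "finite B" "B \<subseteq> carrier L"
    and "\<And>a. a \<in> A \<Longrightarrow> \<exists>b\<in>B. b \<sqsubseteq> a"
  shows "\<Sqinter>B \<sqsubseteq> \<Sqinter>A"
proof -
  have B: "B \<noteq> {}" using assms by blast
  then have c: "\<Sqinter>B \<in> carrier L" using assms by simp
  have "\<forall>b\<in>B. \<Sqinter>B \<sqsubseteq> b" using le_finite_Inf_iff[OF assms(4,5) B c] c by simp
  then show ?thesis
    using le_finite_Inf_iff[OF assms(1-3) c] assms c by (meson le_trans subsetD)
qed

text \<open>Each index contributes at most one element, and an index with value \<open>b\<close>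
  contributes none. So the set is part of the image of the finite set of exceptional
  indices.\<close>

lemma finite_Elem_image:
  assumes fin: "finite {i \<in> I. g i \<noteq> b}" and b: "b \<in> {Bot, Top}"
    and g: "\<And>i. i \<in> I \<Longrightarrow> g i \<in> insert b (Elem ` carrier (L i))"
    and \<phi>: "\<And>i. i \<in> I \<Longrightarrow> \<phi> i \<in> carrier (L i) \<rightarrow> carrier M"
  shows "finite {\<phi> i x | i x. i \<in> I \<and> g i = Elem x}"
    and "{\<phi> i x | i x. i \<in> I \<and> g i = Elem x} \<subseteq> carrier M"
proof -
  have "{\<phi> i x | i x. i \<in> I \<and> g i = Elem x} \<subseteq>
      (\<lambda>i. \<phi> i (case g i of Elem x \<Rightarrow> x)) ` {i \<in> I. g i \<noteq> b}"
  proof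
    fix d assume "d \<in> {\<phi> i x | i x. i \<in> I \<and> g i = Elem x}"
    then obtain i x where "i \<in> I" "g i = Elem x" "d = \<phi> i x" by blast
    with b show "d \<in> (\<lambda>i. \<phi> i (case g i of Elem x \<Rightarrow> x)) ` {i \<in> I. g i \<noteq> b}"
      by (intro image_eqI[of _ _ i]) auto
  qed
  then show "finite {\<phi> i x | i x. i \<in> I \<and> g i = Elem x}"
    using fin by (rule finite_subset[OF _ finite_imageI])
  show "{\<phi> i x | i x. i \<in> I \<and> g i = Elem x} \<subseteq> carrier M"
  proof
    fix d assume "d \<in> {\<phi> i x | i x. i \<in> I \<and> g i = Elem x}"
    then obtain i x where d: "i \<in> I" "g i = Elem x" "d = \<phi> i x" by blast
    with g[OF d(1)] b have "x \<in> carrier (L i)" by auto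
    with \<phi>[OF d(1)] d(3) show "d \<in> carrier M" by auto
  qed
qed

lemma term_product_isotone_extension:
  fixes L :: "'i \<Rightarrow> 'a gorder" and M :: "'m gorder"
  assumes nt: "nontrivial_variety TYPE('w) V" and L: "\<And>i. i \<in> I \<Longrightarrow> in_variety V (L i)"
    and M: "Lattice.lattice M" and m: "m \<in> carrier M"
    and \<phi>: "\<And>i. i \<in> I \<Longrightarrow> \<phi> i \<in> carrier (L i) \<rightarrow> carrier M"
    and iso: "\<And>i. i \<in> I \<Longrightarrow> isotone (L i) M (\<phi> i)"
  obtains \<psi> where "\<psi> \<in> carrier (term_product V I L) \<rightarrow> carrier M"
    "isotone (term_product V I L) M \<psi>"
    "\<And>i x. i \<in> I \<Longrightarrow> x \<in> carrier (L i) \<Longrightarrow> \<psi> (term_inj V I L i x) = \<phi> i x"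
proof -
  interpret M: Lattice.lattice M by (fact M)
  let ?T = "term_product V I L" and ?k = "term_inj V I L"
  obtain h0 where h0: "\<forall>i\<in>I. lattice_hom ?T (bounded_ext (L i)) (h0 i)"
    and h0k: "\<forall>i\<in>I. \<forall>k\<in>I. \<forall>x\<in>carrier (L k).
      h0 i (?k k x) = (if k = i then Elem x else Bot)"
    and fin0: "\<forall>z\<in>carrier ?T. finite {i \<in> I. h0 i z \<noteq> Bot}"
    and v0: "\<forall>z\<in>carrier ?T. \<forall>i\<in>I. h0 i z \<in> insert Bot (Elem ` carrier (L i))"
    by (rule exE[OF cover_homs[of V I L Bot, OF nt L]]) (simp, simp, elim conjE, rule that)
  obtain h1 where h1: "\<forall>i\<in>I. lattice_hom ?T (bounded_ext (L i)) (h1 i)"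
    and h1k: "\<forall>i\<in>I. \<forall>k\<in>I. \<forall>x\<in>carrier (L k).
      h1 i (?k k x) = (if k = i then Elem x else Top)"
    and fin1: "\<forall>z\<in>carrier ?T. finite {i \<in> I. h1 i z \<noteq> Top}"
    and v1: "\<forall>z\<in>carrier ?T. \<forall>i\<in>I. h1 i z \<in> insert Top (Elem ` carrier (L i))"
    by (rule exE[OF cover_homs[of V I L Top, OF nt L]]) (simp, simp, elim conjE, rule that)
  note h0 = h0[rule_format] and h0k = h0k[rule_format]
    and fin0 = fin0[rule_format] and v0 = v0[rule_format]
    and h1 = h1[rule_format] and h1k = h1k[rule_format]
    and fin1 = fin1[rule_format] and v1 = v1[rule_format]
  define D where "D z = {\<phi> i x | i x. i \<in> I \<and> h0 i z = Elem x}" for z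
  \<comment> \<open>The element \<open>m\<close> keeps \<open>U z\<close> nonempty, and the meet of
    \<open>U z\<close> does the same for the join defining \<psi>. Both are needed: at a join of
    elements of two different factors all values of \<open>h1\<close> are \<open>Top\<close>, and at
    a meet of such elements all values of \<open>h0\<close> are \<open>Bot\<close>.\<close>
  define U where "U z = insert m {\<phi> i x | i x. i \<in> I \<and> h1 i z = Elem x}" for z
  define \<psi> where "\<psi> z = \<Squnion>\<^bsub>M\<^esub>(insert (\<Sqinter>\<^bsub>M\<^esub>(U z)) (D z))" for z
  have D: "finite (D z)" "D z \<subseteq> carrier M" if z: "z \<in> carrier ?T" for z
    unfolding D_def using finite_Elem_image[where L = L and \<phi> = \<phi>, OF fin0[OF z] _ v0[OF z] \<phi>] by simp_all
  have U: "finite (U z)" "U z \<subseteq> carrier M" "U z \<noteq> {}" if z: "z \<in> carrier ?T" for z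
    unfolding U_def using finite_Elem_image[where L = L and \<phi> = \<phi>, OF fin1[OF z] _ v1[OF z] \<phi>] m by simp_all
  have DU: "finite (insert (\<Sqinter>\<^bsub>M\<^esub>(U z)) (D z))" "insert (\<Sqinter>\<^bsub>M\<^esub>(U z)) (D z) \<subseteq> carrier M"
    if "z \<in> carrier ?T" for z
    using D[OF that] U[OF that] by auto
  show thesis
  proof (rule that[of \<psi>])
    show "\<psi> \<in> carrier ?T \<rightarrow> carrier M"
      unfolding \<psi>_def using DU by auto
    show "isotone ?T M \<psi>"
    proof (rule isotoneI)
      show "weak_partial_order ?T" "weak_partial_order M"
        by (intro partial_order_imp_weak lattice_imp_partial_order lattice_term_product M)+
      fix z z' assume z: "z \<in> carrier ?T" "z' \<in> carrier ?T" "z \<sqsubseteq>\<^bsub>?T\<^esub> z'"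
      have 0: "h0 i z \<sqsubseteq>\<^bsub>bounded_ext (L i)\<^esub> h0 i z'"
        and 1: "h1 i z \<sqsubseteq>\<^bsub>bounded_ext (L i)\<^esub> h1 i z'" if "i \<in> I" for i
        using lattice_hom_isotone[OF h0[OF that]] lattice_hom_isotone[OF h1[OF that]] z
        unfolding isotone_def by blast+
      have dd: "\<exists>d'\<in>D z'. d \<sqsubseteq>\<^bsub>M\<^esub> d'" if d: "d \<in> D z" for d
      proof -
        obtain i x where ix: "i \<in> I" "h0 i z = Elem x" "d = \<phi> i x"
          using d by (auto simp: D_def)
        \<comment> \<open>A value above \<open>Elem x\<close> is not \<open>Bot\<close>, and
          \<open>v0\<close> excludes \<open>Top\<close>, so the index \<open>i\<close> still
          contributes at \<open>z'\<close>.\<close>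
        then obtain y where y: "h0 i z' = Elem y" "y \<in> carrier (L i)" "x \<sqsubseteq>\<^bsub>L i\<^esub> y"
          using 0[OF ix(1)] v0[OF z(2) ix(1)] by auto
        have "x \<in> carrier (L i)" using v0[OF z(1) ix(1)] ix by auto
        then have "\<phi> i x \<sqsubseteq>\<^bsub>M\<^esub> \<phi> i y" using iso[OF ix(1)] y by (simp add: isotone_def)
        then show ?thesis using ix y by (auto simp: D_def)
      qed
      \<comment> \<open>The search runs from \<open>z'\<close> back to \<open>z\<close>: a value of
        \<open>h1\<close> below \<open>Elem y\<close> is not \<open>Top\<close>, and
        \<open>v1\<close> excludes \<open>Bot\<close>. The element \<open>m\<close> is matched with
        itself.\<close>
      have uu: "\<exists>d\<in>U z. d \<sqsubseteq>\<^bsub>M\<^esub> d'" if d': "d' \<in> U z'" for d'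
      proof (cases "d' = m")
        case True
        then show ?thesis using m by (auto simp: U_def)
      next
        case False
        then obtain i y where ix: "i \<in> I" "h1 i z' = Elem y" "d' = \<phi> i y"
          using d' False by (auto simp: U_def)
        then obtain x where x: "h1 i z = Elem x" "x \<in> carrier (L i)" "x \<sqsubseteq>\<^bsub>L i\<^esub> y"
          using 1[OF ix(1)] v1[OF z(1) ix(1)] by auto
        have "y \<in> carrier (L i)" using v1[OF z(2) ix(1)] ix by auto
        then have "\<phi> i x \<sqsubseteq>\<^bsub>M\<^esub> \<phi> i y" using iso[OF ix(1)] x by (simp add: isotone_def)
        moreover have "\<phi> i x \<in> U z" using ix x by (auto simp: U_def)
        ultimately show ?thesis using ix(3) by blast
      qed
      have "\<Sqinter>\<^bsub>M\<^esub>(U z) \<sqsubseteq>\<^bsub>M\<^esub> \<Sqinter>\<^bsub>M\<^esub>(U z')"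
        by (rule M.finite_Inf_mono[OF U[OF z(2)] U(1,2)[OF z(1)] uu])
      then show "\<psi> z \<sqsubseteq>\<^bsub>M\<^esub> \<psi> z'"
        unfolding \<psi>_def using dd by (intro M.finite_Sup_mono DU z) auto
    qed
    fix i x assume i: "i \<in> I" "x \<in> carrier (L i)"
    have c: "\<phi> i x \<in> carrier M" using \<phi>[OF i(1)] i(2) by auto
    have T: "?k i x \<in> carrier ?T"
      using lattice_homD(3)[OF term_inj_hom[of I V L, OF L i(1)] i(2)] by blast
    \<comment> \<open>On the image of \<open>L i\<close>, every index other than \<open>i\<close>
      has an adjoined value in both families, so only \<phi> at \<open>i\<close>
      contributes.\<close>
    have "k \<in> I \<and> h0 k (?k i x) = Elem y \<longleftrightarrow> k = i \<and> y = x"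
      and "k \<in> I \<and> h1 k (?k i x) = Elem y \<longleftrightarrow> k = i \<and> y = x" for k y
      using i by (auto simp: h0k h1k split: if_splits)
    then have d: "D (?k i x) = {\<phi> i x}" and u: "U (?k i x) = {m, \<phi> i x}"
      by (simp_all add: D_def U_def)
    have "\<Sqinter>\<^bsub>M\<^esub>{m, \<phi> i x} \<sqsubseteq>\<^bsub>M\<^esub> \<phi> i x"
      using M.meet_right[OF m c] by (simp add: meet_def)
    moreover have "\<Sqinter>\<^bsub>M\<^esub>{m, \<phi> i x} \<in> carrier M" using m c by simp
    ultimately have "\<Sqinter>\<^bsub>M\<^esub>{m, \<phi> i x} \<squnion>\<^bsub>M\<^esub> \<phi> i x = \<phi> i x"
      using c by (intro join_eqI[OF M]) auto
    then show "\<psi> (?k i x) = \<phi> i x" by (simp add: \<psi>_def d u join_def)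
  qed
qed

section \<open>Transfer from the term product to an arbitrary free product\<close>

theorem theorem3:
  fixes V :: "(nat lterm \<times> nat lterm) set"
    and I :: "'i set"
    and L :: "'i \<Rightarrow> 'a gorder"
    and F :: "'f gorder"
    and j :: "'i \<Rightarrow> 'a \<Rightarrow> 'f"
    and M :: "'m gorder"
    and \<phi> :: "'i \<Rightarrow> 'a \<Rightarrow> 'm"
  assumes "nontrivial_variety TYPE('w) V"
    and "\<forall>i\<in>I. in_variety V (L i)"
    and "free_product V I L F j"
    and "Lattice.lattice M" and "carrier M \<noteq> {}"
    and "\<forall>i\<in>I. \<phi> i \<in> carrier (L i) \<rightarrow> carrier M \<and> isotone (L i) M (\<phi> i)"
  shows "\<exists>\<psi>. \<psi> \<in> carrier F \<rightarrow> carrier M \<and> isotone F M \<psi> \<and>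
           (\<forall>i\<in>I. \<forall>x\<in>carrier (L i). \<psi> (j i x) = \<phi> i x)"
proof -
  obtain m where m: "m \<in> carrier M" using assms(5) by blast
  have L: "\<And>i. i \<in> I \<Longrightarrow> in_variety V (L i)" using assms(2) by blast
  have wF: "weak_partial_order F" and wM: "weak_partial_order M"
    using assms(3,4)
    by (auto simp: free_product_def in_variety_def
        intro!: partial_order_imp_weak lattice_imp_partial_order)
  show ?thesis
  proof (cases "I = {}")
    \<comment> \<open>For the empty family the term product has no elements and is not a member of
      the variety. No values are prescribed, so a constant map works.\<close>
    case True
    interpret M: Lattice.lattice M by (fact assms(4))
    have "isotone F M (\<lambda>_. m)" by (rule isotoneI[OF wF wM]) (simp add: m)
    then show ?thesis using True m by (intro exI[of _ "\<lambda>_. m"]) simp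
  next
    case False
    let ?T = "term_product V I L" and ?k = "term_inj V I L"
    have T: "in_variety V ?T" by (rule term_product_in_variety[OF False L])
    have k: "\<forall>i\<in>I. lattice_hom (L i) ?T (?k i)"
      by (rule ballI, rule term_inj_hom[OF L])
    \<comment> \<open>This is the test type on which the term product lives. The resulting
      homomorphism \<open>r\<close> matches the canonical maps and is isotone, so the extension on
      the term product can be pulled back along it.\<close>
    have u: "universal_for TYPE(('i \<times> 'a) lterm set) V I L F j"
      using assms(3) by (simp add: free_product_def)
    obtain r where r: "lattice_hom F ?T r"
      "\<forall>i\<in>I. \<forall>x\<in>carrier (L i). r (j i x) = ?k i x"
      using universal_forE[OF u T k] .
    obtain \<psi> where \<psi>: "\<psi> \<in> carrier ?T \<rightarrow> carrier M" "isotone ?T M \<psi>"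
      "\<And>i x. i \<in> I \<Longrightarrow> x \<in> carrier (L i) \<Longrightarrow> \<psi> (?k i x) = \<phi> i x"
      by (rule term_product_isotone_extension[where \<phi> = \<phi> and I = I and L = L, OF assms(1) L assms(4) m])
        (use assms(6) in auto)
    have rc: "r \<in> carrier F \<rightarrow> carrier ?T" using r(1) by (simp add: lattice_hom_def)
    have "isotone F M (\<psi> \<circ> r)"
      using rc \<psi>(2) lattice_hom_isotone[OF r(1)] by (auto simp: isotone_def Pi_iff)
    moreover have "\<psi> \<circ> r \<in> carrier F \<rightarrow> carrier M" using rc \<psi>(1) by auto
    ultimately show ?thesis using r(2) \<psi>(3) by (intro exI[of _ "\<psi> \<circ> r"]) simp
  qed
qed

end
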